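(* For each complete folding sequence $S$, there exists a complete folding curve $D$ whose associated sequence is locally isomorphic to $S$ and such that $\{D\}$ is a covering of $\mathbb{R}^2$, i.e. every edge $[(x,y),(x+1,y)]$ or $[(x,y),(x,y+1)]$ with $x,y\in\mathbb{Z}$ is the support of exactly one segment of $D$.
   Context: All sequences take values in $\{+1,-1\}$. For $S=(a_1,\dots,a_n)$ write $\overline{S}=(-a_n,\dots,-a_1)$. The $n$-folding sequences are defined recursively: the only $0$-folding sequence is the empty sequence, and the $(n+1)$-folding sequences are exactly $(\overline{S},+1,S)$ and $(\overline{S},-1,S)$ with $S$ an $n$-folding sequence. A subword of a sequence $(b_k)$ is a block $(b_{h+1},\dots,b_{h+m})$. A complete folding sequence is a sequence $(a_k)_{k\in\mathbb{Z}}$ each finite subword of which is a subword of some $n$-folding sequence. Two sequences indexed by $\mathbb{Z}$ are locally isomorphic if they have the same finite subwords. A segment is an oriented unit edge of $\mathbb{Z}^2$. A complete curve is a sequence $(C_i)_{i\in\mathbb{Z}}$ of segments such that the terminal point of $C_i$ is the initial point of $C_{i+1}$, consecutive supports are perpendicular, and all supports are pairwise distinct; its associated sequence is $(\eta_i)_{i\in\mathbb{Z}}$ with $\eta_i=+1$ (resp. $-1$) if one turns left (resp. right) from $C_i$ to $C_{i+1}$. A complete folding curve is a complete curve whose associated sequence is a complete folding sequence. *)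

theory Defs
  imports "HOL-Analysis.Analysis" "HOL-Library.Sublist"
begin

definition bar :: "int list \<Rightarrow> int list" where
  "bar S = rev (map uminus S)"

primrec folding_sequences :: "nat \<Rightarrow> int list set" where
  "folding_sequences 0 = {[]}"
| "folding_sequences (Suc n) =
     {bar S @ [e] @ S | S e. S \<in> folding_sequences n \<and> e \<in> {1, -1}}"

definition subwords :: "(int \<Rightarrow> int) \<Rightarrow> int list set" where
  "subwords a = {map (\<lambda>k. a (h + int k)) [1..<Suc m] | h m. True}"

text \<open>Values in \<open>{1, -1}\<close> are enforced by the subwords of length one;
  \<^const>\<open>sublist\<close> is the contiguous-block relation on lists.\<close>

definition complete_folding_sequence :: "(int \<Rightarrow> int) \<Rightarrow> bool" where
  "complete_folding_sequence a \<longleftrightarrow>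
     (\<forall>w \<in> subwords a. \<exists>n. \<exists>T \<in> folding_sequences n. sublist w T)"

definition locally_isomorphic :: "(int \<Rightarrow> int) \<Rightarrow> (int \<Rightarrow> int) \<Rightarrow> bool" where
  "locally_isomorphic a b \<longleftrightarrow> subwords a = subwords b"

text \<open>An oriented edge is the pair of its initial and terminal points.\<close>

type_synonym segment = "(int \<times> int) \<times> (int \<times> int)"

definition direction :: "segment \<Rightarrow> int \<times> int" where
  "direction s = snd s - fst s"

definition is_segment :: "segment \<Rightarrow> bool" where
  "is_segment s \<longleftrightarrow> direction s \<in> {(1, 0), (-1, 0), (0, 1), (0, -1)}"

definition pt :: "int \<times> int \<Rightarrow> real \<times> real" where
  "pt p = (real_of_int (fst p), real_of_int (snd p))"

definition support :: "segment \<Rightarrow> (real \<times> real) set" where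
  "support s = closed_segment (pt (fst s)) (pt (snd s))"

definition complete_curve :: "(int \<Rightarrow> segment) \<Rightarrow> bool" where
  "complete_curve C \<longleftrightarrow>
     (\<forall>i. is_segment (C i)) \<and>
     (\<forall>i. snd (C i) = fst (C (i + 1))) \<and>
     (\<forall>i. orthogonal (pt (direction (C i))) (pt (direction (C (i + 1))))) \<and>
     (\<forall>i j. i \<noteq> j \<longrightarrow> support (C i) \<noteq> support (C j))"

definition left_turn :: "segment \<Rightarrow> segment \<Rightarrow> bool" where
  "left_turn s t \<longleftrightarrow>
     fst (direction s) * snd (direction t) - snd (direction s) * fst (direction t) > 0"

definition associated_sequence :: "(int \<Rightarrow> segment) \<Rightarrow> int \<Rightarrow> int" where
  "associated_sequence C i = (if left_turn (C i) (C (i + 1)) then 1 else -1)"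

definition complete_folding_curve :: "(int \<Rightarrow> segment) \<Rightarrow> bool" where
  "complete_folding_curve C \<longleftrightarrow>
     complete_curve C \<and> complete_folding_sequence (associated_sequence C)"

definition covers_plane :: "(int \<Rightarrow> segment) \<Rightarrow> bool" where
  "covers_plane C \<longleftrightarrow>
     (\<forall>x y :: int.
        (\<exists>!i. support (C i) = closed_segment (pt (x, y)) (pt (x + 1, y))) \<and>
        (\<exists>!i. support (C i) = closed_segment (pt (x, y)) (pt (x, y + 1))))"

end

theory Submission
  imports Defs
begin

text \<open>
  A complete folding sequence is a Toeplitz sequence: for a 2-adic shift \<open>r\<close>, its value at
  \<open>2 ^ k * (2 * j + 1) - r\<close> is \<open>(-1) ^ j * s k\<close>, and the signs \<open>s\<close> alone determine its finite
  subwords. It therefore suffices to cover the grid by one curve with prescribed \<open>s\<close>.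

  Merging consecutive edges in pairs turns a covering of the grid by folding curves into one of a
  grid coarser by a factor \<open>1 + s i\<close>, where \<open>s\<close> is the sign of the current level. Going backwards,
  every choice of an origin at each level yields such a covering, and two edges lie on the same
  curve as soon as they have a common ancestor. Any two edges can be given one by choosing the
  next few origins suitably: the vector between them shrinks by a factor \<open>sqrt 2\<close> up to a bounded
  error, which leaves finitely many relative positions to inspect. Doing this successively for all
  edges produces a single curve.
\<close>

section \<open>Toeplitz structure of folding sequences\<close>

text \<open>\<open>toeplitz n s p\<close> is \<open>(-1) ^ j * s k\<close> for \<open>p = 2 ^ k * (2 * j + 1)\<close> with \<open>k < n\<close>;
  the value \<open>0\<close> marks the positions divisible by \<open>2 ^ n\<close>, which level \<open>n\<close> leaves open.\<close>

primrec toeplitz :: "nat \<Rightarrow> (nat \<Rightarrow> int) \<Rightarrow> int \<Rightarrow> int" where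
  "toeplitz 0 s p = 0"
| "toeplitz (Suc n) s p =
     (if even p then toeplitz n (\<lambda>k. s (Suc k)) (p div 2)
      else if p mod 4 = 1 then s 0 else - s 0)"

definition signs :: "(nat \<Rightarrow> int) \<Rightarrow> bool" where
  "signs s \<longleftrightarrow> (\<forall>n. s n \<in> {1, -1})"

text \<open>The shifts \<open>r\<close> stand for approximations of one 2-adic shift. A position
  left open at every level is unconstrained.\<close>

definition folding_type :: "(nat \<Rightarrow> int) \<Rightarrow> (int \<Rightarrow> int) \<Rightarrow> bool" where
  "folding_type s a \<longleftrightarrow>
     (\<forall>n. \<exists>r. \<forall>k. toeplitz n s (k + r) \<noteq> 0 \<longrightarrow> a k = toeplitz n s (k + r))"

section \<open>Basic properties of Toeplitz values\<close>

lemma signs_shift: "signs s \<Longrightarrow> signs (\<lambda>k. s (m + k))"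
  by (simp add: signs_def)

lemma signs_Suc: "signs s \<Longrightarrow> signs (\<lambda>k. s (Suc k))"
  by (simp add: signs_def)

lemma toeplitz_eq_0_iff: "signs s \<Longrightarrow> toeplitz n s p = 0 \<longleftrightarrow> 2 ^ n dvd p"
proof (induction n arbitrary: s p)
  case (Suc n)
  have "s 0 \<noteq> 0" using Suc.prems by (auto simp: signs_def dest: spec[of _ 0])
  then show ?case
  proof (cases "even p")
    case True
    then obtain q where "p = 2 * q" by blast
    then show ?thesis using Suc.IH[OF signs_Suc[OF Suc.prems]] by simp
  next
    case False
    then have "\<not> 2 ^ Suc n dvd p" by (metis dvd_mult_left power_Suc)
    then show ?thesis using False \<open>s 0 \<noteq> 0\<close> by simp
  qed
qed simp

lemma toeplitz_values: "signs s \<Longrightarrow> toeplitz n s p \<in> {0, 1, -1}"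
proof (induction n arbitrary: s p)
  case (Suc n)
  have "s 0 \<in> {1, -1}" using Suc.prems by (simp add: signs_def)
  then show ?case using Suc.IH[OF signs_Suc[OF Suc.prems], of "p div 2"] by auto
qed simp

lemma toeplitz_periodic: "toeplitz n s (p + 2 ^ Suc n * c) = toeplitz n s p"
proof (induction n arbitrary: s p)
  case (Suc n)
  have eq: "(p + 2 ^ Suc (Suc n) * c) = p + 4 * (2 ^ n * c)" by simp
  have "(p + 2 ^ Suc (Suc n) * c) mod 4 = p mod 4" unfolding eq by presburger
  moreover have "(p + 2 ^ Suc (Suc n) * c) div 2 = p div 2 + 2 ^ Suc n * c" by simp
  ultimately show ?case using Suc.IH[of "\<lambda>k. s (Suc k)" "p div 2"] by simp
qed simp

lemma toeplitz_periodic_mod: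
  assumes "a mod 2 ^ Suc n = b mod 2 ^ Suc n"
  shows "toeplitz n s (k + a) = toeplitz n s (k + b)"
proof -
  obtain c where "a = b + 2 ^ Suc n * c"
    using assms by (metis mod_eqE)
  then show ?thesis using toeplitz_periodic[of n s "k + b" c] by (simp add: add.assoc)
qed

lemma toeplitz_add: "toeplitz n s p \<noteq> 0 \<Longrightarrow> toeplitz (n + j) s p = toeplitz n s p"
  by (induction n arbitrary: s p) auto

lemma toeplitz_unique:
  assumes "toeplitz n s p \<noteq> 0" "toeplitz m s p \<noteq> 0"
  shows "toeplitz n s p = toeplitz m s p"
  using assms toeplitz_add by (metis le_add_diff_inverse nat_le_linear)

lemma toeplitz_cong: "(\<And>k. k < n \<Longrightarrow> s k = s' k) \<Longrightarrow> toeplitz n s p = toeplitz n s' p"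
proof (induction n arbitrary: s s' p)
  case (Suc n)
  have "toeplitz n (\<lambda>k. s (Suc k)) q = toeplitz n (\<lambda>k. s' (Suc k)) q" for q
    by (rule Suc.IH) (simp add: Suc.prems)
  moreover have "s 0 = s' 0" by (simp add: Suc.prems)
  ultimately show ?case by simp
qed simp

text \<open>Negation exchanges the classes 1 and 3 modulo 4. This is the Toeplitz form of the
  antisymmetry in \<open>bar\<close>.\<close>

lemma toeplitz_minus: "toeplitz n s (- p) = - toeplitz n s p"
proof (induction n arbitrary: s p)
  case (Suc n)
  show ?case
  proof (cases "even p")
    case True
    then have "(- p) div 2 = - (p div 2)" by presburger
    then show ?thesis using Suc.IH[of "\<lambda>k. s (Suc k)" "p div 2"] True by simp
  next
    case False
    then have "(- p) mod 4 = 1 \<longleftrightarrow> p mod 4 \<noteq> 1" by presburger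
    then show ?thesis using False by simp
  qed
qed simp

lemma toeplitz_power2: "toeplitz (n + m) s (2 ^ n * q) = toeplitz m (\<lambda>k. s (n + k)) q"
  by (induction n arbitrary: s) (auto simp: mult.assoc)

text \<open>The term \<open>2 * c\<close> preserves the parity of \<open>q\<close>. Both signs occur
  for odd values, at 1 and 3, and for even ones, at 2 and 6.\<close>

lemma toeplitz_attains:
  assumes "signs s" "v \<in> {1, -1}"
  shows "\<exists>c. toeplitz (n + 3) s (2 ^ n * (q + 2 * c)) = v"
proof -
  have s: "s n \<in> {1, -1}" "s (Suc n) \<in> {1, -1}" using assms(1) by (simp_all add: signs_def)
  have "\<exists>x. toeplitz 3 (\<lambda>k. s (n + k)) x = v \<and> (even x \<longleftrightarrow> even q)"
  proof (cases "even q")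
    case True
    have "toeplitz 3 (\<lambda>k. s (n + k)) 2 = s (Suc n)" "toeplitz 3 (\<lambda>k. s (n + k)) 6 = - s (Suc n)"
      by (simp_all add: numeral_3_eq_3)
    moreover have "even (2::int)" "even (6::int)" by simp_all
    ultimately show ?thesis using s assms(2) True by (metis insertE minus_minus singletonD)
  next
    case False
    have "toeplitz 3 (\<lambda>k. s (n + k)) 1 = s n" "toeplitz 3 (\<lambda>k. s (n + k)) 3 = - s n"
      by (simp_all add: numeral_3_eq_3)
    moreover have "odd (1::int)" "odd (3::int)" by simp_all
    ultimately show ?thesis using s assms(2) False by (metis insertE minus_minus singletonD)
  qed
  then obtain x where x: "toeplitz 3 (\<lambda>k. s (n + k)) x = v" "even x \<longleftrightarrow> even q" by blast
  then have "q + 2 * ((x - q) div 2) = x" by presburger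
  then show ?thesis using x(1) toeplitz_power2[of n 3 s x] by metis
qed

text \<open>A window shorter than \<open>2 ^ n\<close> meets at most one position left open at level \<open>n\<close>. Both values
  occur there after a shift by a multiple of \<open>2 ^ (n + 1)\<close>, which preserves all other positions.\<close>

lemma folding_type_subwords:
  assumes s: "signs s" and a: "folding_type s a" and b: "folding_type s b"
    and vals: "\<And>k. a k \<in> {1, -1}"
  shows "subwords a \<subseteq> subwords b"
proof
  fix w assume "w \<in> subwords a"
  then obtain h m where w: "w = map (\<lambda>k. a (h + int k)) [1..<Suc m]"
    unfolding subwords_def by blast
  define n where "n = m"
  have big: "int m < 2 ^ n" unfolding n_def
    by (metis of_nat_less_two_power)
  obtain r where r: "\<And>k. toeplitz n s (k + r) \<noteq> 0 \<Longrightarrow> a k = toeplitz n s (k + r)"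
    using a unfolding folding_type_def by meson
  obtain r' where r': "\<And>k. toeplitz (n + 3) s (k + r') \<noteq> 0 \<Longrightarrow> b k = toeplitz (n + 3) s (k + r')"
    using b unfolding folding_type_def by meson
  have "\<exists>c. \<forall>k\<in>{h+1..h+int m}. toeplitz (n + 3) s (k + r + 2 ^ Suc n * c) = a k"
  proof -
    \<comment> \<open>Positions closed at level \<open>n\<close> are affected neither by the shift
      nor by the three extra levels.\<close>
    have reg: "toeplitz (n + 3) s (k + r + 2 ^ Suc n * c) = a k"
      if "toeplitz n s (k + r) \<noteq> 0" for k c
      using that r[OF that] toeplitz_periodic[of n s "k + r" c]
        toeplitz_add[of n s "k + r + 2 ^ Suc n * c" 3] by simp
    show ?thesis
    proof (cases "\<exists>k0\<in>{h+1..h+int m}. toeplitz n s (k0 + r) = 0")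
      case True
      then obtain k0 where k0: "k0 \<in> {h+1..h+int m}" "2 ^ n dvd k0 + r"
        using toeplitz_eq_0_iff[OF s] by blast
      then obtain q where q: "k0 + r = 2 ^ n * q" by blast
      obtain c where c: "toeplitz (n + 3) s (2 ^ n * (q + 2 * c)) = a k0"
        using toeplitz_attains[OF s vals] by blast
      have "toeplitz (n + 3) s (k + r + 2 ^ Suc n * c) = a k" if k: "k \<in> {h+1..h+int m}" for k
      proof (cases "k = k0")
        case True
        have "k + r + 2 ^ Suc n * c = 2 ^ n * (q + 2 * c)" using True q by (simp add: algebra_simps)
        then show ?thesis using c True by simp
      next
        case False
        have "\<not> 2 ^ n dvd k + r"
        proof
          assume "2 ^ n dvd k + r"
          then have "2 ^ n dvd (k + r) - (k0 + r)" using k0(2) dvd_diff by blast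
          then have "2 ^ n dvd \<bar>k - k0\<bar>" by simp
          then have "2 ^ n \<le> \<bar>k - k0\<bar>" using False by (intro zdvd_imp_le) auto
          moreover have "\<bar>k - k0\<bar> < int m" using k k0(1) by auto
          ultimately show False using big by linarith
        qed
        then show ?thesis using reg toeplitz_eq_0_iff[OF s] by blast
      qed
      then show ?thesis by blast
    next
      case False
      then show ?thesis using reg by blast
    qed
  qed
  then obtain c where c: "\<And>k. k \<in> {h+1..h+int m} \<Longrightarrow> toeplitz (n + 3) s (k + r + 2 ^ Suc n * c) = a k"
    by blast
  define d where "d = r - r' + 2 ^ Suc n * c"
  have "b (h + d + int k) = a (h + int k)" if "k \<in> set [1..<Suc m]" for k
  proof -
    have "toeplitz (n + 3) s ((h + d + int k) + r') = a (h + int k)"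
      using c[of "h + int k"] that by (auto simp: d_def algebra_simps)
    moreover have "a (h + int k) \<noteq> 0" using vals[of "h + int k"] by auto
    ultimately show ?thesis using r'[of "h + d + int k"] by simp
  qed
  then have "w = map (\<lambda>k. b (h + d + int k)) [1..<Suc m]" unfolding w by simp
  then show "w \<in> subwords b" unfolding subwords_def by blast
qed

text \<open>With the offset \<open>2 ^ N\<close>, and modulo the period \<open>2 ^ Suc N\<close>,
  the right half of a sequence of level \<open>Suc N\<close> occupies the positions of
  \<open>U\<close> and the left half their negatives, so \<open>toeplitz_minus\<close> accounts for
  \<open>bar\<close>.\<close>

lemma folding_sequence_toeplitz:
  "T \<in> folding_sequences N \<Longrightarrow> length T = 2 ^ N - 1 \<and>
     (\<exists>s. signs s \<and> (\<forall>i < 2 ^ N - 1. T ! i = toeplitz N s (2 ^ N + int i + 1)))"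
proof (induction N arbitrary: T)
  case 0
  then show ?case by (auto simp: signs_def intro: exI[of _ "\<lambda>_. 1"])
next
  case (Suc N)
  then obtain U e where T: "T = bar U @ [e] @ U" and U: "U \<in> folding_sequences N" and e: "e \<in> {1, -1}"
    by auto
  from Suc.IH[OF U] obtain s where len: "length U = 2 ^ N - 1" and s: "signs s"
    and val: "\<And>i. i < 2 ^ N - 1 \<Longrightarrow> U ! i = toeplitz N s (2 ^ N + int i + 1)" by blast
  \<comment> \<open>The middle letter sits at \<open>2 ^ N * 3\<close>, where the Toeplitz value is
    minus the sign of level \<open>N\<close>.\<close>
  define s' where "s' = s(N := - e)"
  have s': "signs s'" using s e by (auto simp: signs_def s'_def)
  have len': "length (bar U) = 2 ^ N - 1" using len by (simp add: bar_def)
  have pos: "(1::nat) \<le> 2 ^ N" by simp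
  have lift: "toeplitz (Suc N) s' (2 ^ Suc N + p) = toeplitz N s p" if "toeplitz N s p \<noteq> 0" for p
  proof -
    have "toeplitz N s' p = toeplitz N s p" by (rule toeplitz_cong) (simp add: s'_def)
    then have "toeplitz (Suc N) s' (2 ^ Suc N + p) = toeplitz N s' (2 ^ Suc N + p)"
      using toeplitz_add[of N s' "2 ^ Suc N + p" 1] toeplitz_periodic[of N s' p 1] that
      by (simp add: add.commute)
    then show ?thesis using toeplitz_periodic[of N s' p 1] \<open>toeplitz N s' p = toeplitz N s p\<close>
      by (simp add: add.commute)
  qed
  have nz: "toeplitz N s p \<noteq> 0" if "q * 2 ^ N < p" "p < (q + 1) * 2 ^ N" for p q
  proof
    assume "toeplitz N s p = 0"
    then obtain x where "p = 2 ^ N * x" using toeplitz_eq_0_iff[OF s] by blast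
    with that have "q * 2 ^ N < x * 2 ^ N" "x * 2 ^ N < (q + 1) * 2 ^ N" by (simp_all add: mult.commute)
    then have "q < x" "x < q + 1" by simp_all
    then show False by simp
  qed
  have "T ! i = toeplitz (Suc N) s' (2 ^ Suc N + int i + 1)" if i: "i < 2 ^ Suc N - 1" for i
  proof -
    consider "i < 2 ^ N - 1" | "i = 2 ^ N - 1" | "2 ^ N \<le> i" by linarith
    then show ?thesis
    proof cases
      case 1
      define j where "j = 2 ^ N - 2 - i"
      have j: "j < 2 ^ N - 1" "int j = 2 ^ N - 2 - int i" using 1 by (auto simp: j_def of_nat_diff)
      have "T ! i = - U ! j" using 1 len len' unfolding T
        by (simp add: nth_append bar_def rev_nth j_def)
      also have "\<dots> = - toeplitz N s (- (int i + 1 + 2 ^ Suc N * (-1)))"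
        using val[OF j(1)] j(2) by (simp add: algebra_simps)
      also have "\<dots> = toeplitz N s (int i + 1)"
        unfolding toeplitz_minus toeplitz_periodic by simp
      also have "\<dots> = toeplitz (Suc N) s' (2 ^ Suc N + (int i + 1))"
      proof (rule lift[symmetric], rule nz[of 0])
        have "int i + 1 < int (2 ^ N)" using 1 by linarith
        then show "int i + 1 < (0 + 1) * 2 ^ N" by simp
      qed simp
      finally show ?thesis by (simp add: add.assoc)
    next
      case 2
      then have "T ! i = e" using len' unfolding T by (simp add: nth_append)
      moreover have "2 ^ Suc N + int i + 1 = 2 ^ N * 3" using 2 by (simp add: of_nat_diff)
      moreover have "toeplitz (N + 1) s' (2 ^ N * 3) = e" unfolding toeplitz_power2
        by (simp add: s'_def)
      ultimately show ?thesis by (metis Suc_eq_plus1)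
    next
      case 3
      define j where "j = i - 2 ^ N"
      have j: "j < 2 ^ N - 1" "int j = int i - 2 ^ N" using 3 i by (auto simp: j_def of_nat_diff)
      have "i = length (bar U @ [e]) + j" using 3 len' pos by (simp add: j_def)
      then have "T ! i = U ! j" unfolding T by (metis append_assoc nth_append_length_plus)
      also have "\<dots> = toeplitz N s (int i + 1)" using val[OF j(1)] j(2) by (simp add: algebra_simps)
      also have "\<dots> = toeplitz (Suc N) s' (2 ^ Suc N + (int i + 1))"
      proof (rule lift[symmetric], rule nz[of 1])
        have "int i + 1 < int (2 ^ Suc N)" using i by linarith
        then show "int i + 1 < (1 + 1) * 2 ^ N" by simp
        have "int (2 ^ N) \<le> int i" using 3 by linarith
        then show "1 * 2 ^ N < int i + 1" by simp
      qed
      finally show ?thesis by (simp add: add.assoc)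
    qed
  qed
  moreover have "length T = 2 ^ Suc N - 1" using len len' pos unfolding T by simp
  ultimately show ?case using s' by blast
qed

text \<open>Compactness: a prefix is extended one value at a time, always keeping infinitely many
  rows \<open>M\<close> that agree with it.\<close>

lemma finite_valued_limit:
  fixes f :: "nat \<Rightarrow> nat \<Rightarrow> 'a"
  assumes V: "finite V" "\<And>M k. f M k \<in> V"
  shows "\<exists>s. \<forall>n. infinite {M. \<forall>k<n. f M k = s k}"
proof -
  have "\<exists>X. \<forall>n. (length (X n) = n \<and> infinite {M. \<forall>k<n. f M k = X n ! k}) \<and> (\<exists>v. X (Suc n) = X n @ [v])"
  proof (rule dependent_nat_choice)
    show "\<exists>x. length x = 0 \<and> infinite {M. \<forall>k<0. f M k = x ! k}" by auto
  next
    fix x n assume x: "length x = n \<and> infinite {M. \<forall>k<n. f M k = x ! k}"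
    let ?B = "{M. \<forall>k<n. f M k = x ! k}"
    have "finite ((\<lambda>M. f M n) ` ?B)" using V by (meson finite_subset image_subsetI)
    then obtain M0 where "infinite {M \<in> ?B. f M n = f M0 n}"
      using pigeonhole_infinite[of ?B "\<lambda>M. f M n"] x by blast
    moreover have "{M \<in> ?B. f M n = f M0 n} = {M. \<forall>k<Suc n. f M k = (x @ [f M0 n]) ! k}"
      using x by (auto simp: nth_append less_Suc_eq)
    ultimately have "infinite {M. \<forall>k<Suc n. f M k = (x @ [f M0 n]) ! k}" by simp
    then show "\<exists>y. (length y = Suc n \<and> infinite {M. \<forall>k<Suc n. f M k = y ! k}) \<and> (\<exists>v. y = x @ [v])"
      using x by (intro exI[of _ "x @ [f M0 n]"]) auto
  qed
  then obtain X where X': "\<forall>n. (length (X n) = n \<and> infinite {M. \<forall>k<n. f M k = X n ! k}) \<and> (\<exists>v. X (Suc n) = X n @ [v])" ..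
  then have X: "\<And>n. length (X n) = n" "\<And>n. infinite {M. \<forall>k<n. f M k = X n ! k}"
    "\<And>n. \<exists>v. X (Suc n) = X n @ [v]" by simp_all
  have eq: "X n ! k = X (Suc k) ! k" if "k < n" for n k
    using that
  proof (induction n)
    case (Suc n)
    obtain v where "X (Suc n) = X n @ [v]" using X(3) by blast
    then show ?case using X(1)[of n] Suc by (cases "k = n") (simp_all add: nth_append)
  qed simp
  have "{M. \<forall>k<n. f M k = X n ! k} = {M. \<forall>k<n. f M k = X (Suc k) ! k}" for n
    using eq[of _ n] by (intro Collect_cong) metis
  then have "infinite {M. \<forall>k<n. f M k = X (Suc k) ! k}" for n using X(2)[of n] by metis
  then show ?thesis by (intro exI[of _ "\<lambda>k. X (Suc k) ! k"] allI)
qed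

text \<open>A finite window lies in one folding sequence, which supplies signs and a shift. Both
  still depend on \<open>M\<close>.\<close>

lemma complete_folding_sequence_window:
  assumes "complete_folding_sequence S"
  shows "\<exists>s d. signs s \<and> (\<forall>k n. \<bar>k\<bar> \<le> int M \<longrightarrow> S k \<in> {1, -1} \<and>
           (toeplitz n s (k + d) \<noteq> 0 \<longrightarrow> S k = toeplitz n s (k + d)))"
proof -
  define w where "w = map (\<lambda>k. S (- int M - 1 + int k)) [1..<Suc (2 * M + 1)]"
  have "w \<in> subwords S" unfolding w_def subwords_def by blast
  then obtain N T where T: "T \<in> folding_sequences N" "sublist w T"
    using assms unfolding complete_folding_sequence_def by blast
  then obtain ps ss where T_eq: "T = ps @ w @ ss" by (auto simp: sublist_def)
  obtain s where len: "length T = 2 ^ N - 1" and s: "signs s"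
    and val: "\<And>i. i < 2 ^ N - 1 \<Longrightarrow> T ! i = toeplitz N s (2 ^ N + int i + 1)"
    using folding_sequence_toeplitz[OF T(1)] by blast
  define d where "d = 2 ^ N + int (length ps) + int M + 1"
  have main: "S k = toeplitz N s (k + d) \<and> S k \<in> {1, -1}" if k: "\<bar>k\<bar> \<le> int M" for k
  proof -
    define j where "j = nat (k + int M)"
    have j: "j < 2 * M + 1" "int j = k + int M" using k by (auto simp: j_def)
    have lw: "length w = 2 * M + 1" by (simp add: w_def)
    have lt: "length ps + j < 2 ^ N - 1" using j(1) len lw unfolding T_eq by simp
    have "T ! (length ps + j) = w ! j" using j(1) lw unfolding T_eq by (simp add: nth_append)
    also have "\<dots> = S k" using j unfolding w_def by (simp add: nth_append del: upt_Suc)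
    finally have "S k = toeplitz N s (k + d)" using val[OF lt] j(2)
      by (simp add: d_def algebra_simps)
    moreover have "toeplitz N s (2 ^ N + (int (length ps + j) + 1)) \<noteq> 0"
    proof -
      have lt': "int (length ps + j) + 1 < 2 ^ N"
      proof -
        have "int (length ps + j) + 1 < int (2 ^ N)" using lt by linarith
        then show ?thesis by simp
      qed
      have "\<not> 2 ^ N dvd int (length ps + j) + 1"
        using lt' zdvd_imp_le[of "2 ^ N" "int (length ps + j) + 1"] by auto
      then have "\<not> 2 ^ N dvd 2 ^ N + (int (length ps + j) + 1)"
        using dvd_add_right_iff[of "2^N" "2^N :: int"] by (metis dvd_refl)
      then show ?thesis using toeplitz_eq_0_iff[OF s] by blast
    qed
    then have "toeplitz N s (k + d) \<noteq> 0" using j(2) by (simp add: d_def algebra_simps)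
    ultimately show ?thesis using toeplitz_values[OF s, of N "k + d"] by auto
  qed
  \<comment> \<open>The level \<open>n\<close> is arbitrary here: any two levels that close a
    position agree on it.\<close>
  have "S k = toeplitz n s (k + d)" if "\<bar>k\<bar> \<le> int M" "toeplitz n s (k + d) \<noteq> 0" for k n
  proof -
    have "toeplitz N s (k + d) \<noteq> 0" using main[OF that(1)] by auto
    then show ?thesis using main[OF that(1)] that(2) toeplitz_unique by metis
  qed
  then show ?thesis using s main by blast
qed

text \<open>Signs are passed to the limit over growing windows by compactness. At level
  \<open>n\<close> only the shift modulo \<open>2 ^ Suc n\<close> matters, so one residue serves
  infinitely many windows.\<close>

lemma complete_folding_sequence_type:
  assumes "complete_folding_sequence S"
  shows "\<exists>s. signs s \<and> folding_type s S"
    and "S k \<in> {1, -1}"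
proof -
  show "S k \<in> {1, -1}"
    using complete_folding_sequence_window[OF assms, of "nat \<bar>k\<bar>"] by (metis abs_ge_zero nat_0_le order_refl)
  obtain f d where f: "\<And>M. signs (f M)"
    and fd: "\<And>M k n. \<bar>k\<bar> \<le> int M \<Longrightarrow> toeplitz n (f M) (k + d M) \<noteq> 0 \<Longrightarrow> S k = toeplitz n (f M) (k + d M)"
    using complete_folding_sequence_window[OF assms] by metis
  have "\<exists>s. \<forall>n. infinite {M. \<forall>k<n. f M k = s k}"
    by (rule finite_valued_limit[of "{1, -1}"]) (use f in \<open>auto simp: signs_def\<close>)
  then obtain s where s: "\<And>n. infinite {M. \<forall>k<n. f M k = s k}" by blast
  have "s n \<in> {1, -1}" for n
  proof -
    obtain M where "\<forall>k<Suc n. f M k = s k" using s[of "Suc n"] not_finite_existsD by blast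
    then have "s n = f M n" by simp
    then show ?thesis using f[of M] by (simp add: signs_def)
  qed
  then have "signs s" by (simp add: signs_def)
  moreover have "folding_type s S" unfolding folding_type_def
  proof
    fix n
    let ?B = "{M. \<forall>k<n. f M k = s k}"
    have "finite ((\<lambda>M. d M mod 2 ^ Suc n) ` ?B)"
      by (rule finite_subset[of _ "{0..<2 ^ Suc n}"]) auto
    then obtain M0 where inf: "infinite {M \<in> ?B. d M mod 2 ^ Suc n = d M0 mod 2 ^ Suc n}"
      using pigeonhole_infinite[OF s[of n], of "\<lambda>M. d M mod 2 ^ Suc n"] by blast
    have "S k = toeplitz n s (k + d M0)" if nz: "toeplitz n s (k + d M0) \<noteq> 0" for k
    proof -
      obtain M where M: "nat \<bar>k\<bar> \<le> M" "M \<in> ?B" "d M mod 2 ^ Suc n = d M0 mod 2 ^ Suc n"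
        using inf unfolding infinite_nat_iff_unbounded_le by blast
      have eq: "toeplitz n (f M) (k + d M) = toeplitz n s (k + d M0)"
        using M(2) toeplitz_cong[of n "f M" s "k + d M"] toeplitz_periodic_mod[OF M(3)] by simp
      have "\<bar>k\<bar> \<le> int M" using M(1) by simp
      then have "S k = toeplitz n (f M) (k + d M)" using fd[of k M n] nz eq by auto
      then show ?thesis using eq by simp
    qed
    then show "\<exists>r. \<forall>k. toeplitz n s (k + r) \<noteq> 0 \<longrightarrow> S k = toeplitz n s (k + r)" by blast
  qed
  ultimately show "\<exists>s. signs s \<and> folding_type s S" by blast
qed

section \<open>Coarsening the grid\<close>

text \<open>Every grid edge has exactly one endpoint with even coordinate sum. An edge is encoded by this
  endpoint and the unit vector towards the other one. Horizontal edges are traversed away from the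
  even endpoint, vertical ones towards it.\<close>

type_synonym edge = "(int \<times> int) \<times> (int \<times> int)"

definition edges :: "edge set" where
  "edges = {((x, y), (a, b)) | x y a b. even (x + y) \<and> (a, b) \<in> {(1, 0), (-1, 0), (0, 1), (0, -1)}}"

fun vert :: "edge \<Rightarrow> bool" where
  "vert ((x, y), (a, b)) \<longleftrightarrow> a = 0"

fun seg :: "edge \<Rightarrow> segment" where
  "seg ((x, y), (a, b)) = (if a = 0 then ((x + a, y + b), (x, y)) else ((x, y), (x + a, y + b)))"

text \<open>In Gaussian integers the even endpoint \<open>h\<close> is sent to \<open>h / (1 + s i) + t\<close>. Both divisions by 2
  are exact because \<open>h\<close> is even.\<close>

fun parent :: "int \<Rightarrow> int \<Rightarrow> edge \<Rightarrow> edge" where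
  "parent s t ((x, y), (a, b)) =
     (let p = (x + s * y) div 2 + t; q = (y - s * x) div 2 in
      if even (p + q) then ((p, q), (a, b)) else ((p + s * b, q - s * a), (- s * b, s * a)))"

lemma edges_cases [consumes 1, case_names E]:
  assumes "e \<in> edges"
  obtains x y a b where "e = ((x, y), (a, b))" "even (x + y)"
    "(a = 1 \<and> b = 0) \<or> (a = -1 \<and> b = 0) \<or> (a = 0 \<and> b = 1) \<or> (a = 0 \<and> b = -1)"
  using assms by (auto simp: edges_def)

lemma edges_iff: "((x, y), (a, b)) \<in> edges \<longleftrightarrow> even (x + y) \<and>
    ((a = 1 \<and> b = 0) \<or> (a = -1 \<and> b = 0) \<or> (a = 0 \<and> b = 1) \<or> (a = 0 \<and> b = -1))"
  by (auto simp: edges_def)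

lemma parent_edges:
  assumes "s \<in> {1, -1}" "e \<in> edges"
  shows "parent s t e \<in> edges"
  using assms(2)
proof (cases rule: edges_cases)
  case (E x y a b)
  then show ?thesis using assms(1)
    by (auto simp: edges_iff Let_def)
qed

text \<open>The orientation tells the two children of an edge apart. If the image parities differed,
  exactly one unit vector would be rotated by a right angle, against the equal orientations.\<close>

lemma parent_inj:
  assumes "s \<in> {1, -1}" "e \<in> edges" "e' \<in> edges" "parent s t e = parent s t e'" "vert e \<longleftrightarrow> vert e'"
  shows "e = e'"
  using assms(2)
proof (cases rule: edges_cases)
  case (E x y a b)
  note E1 = E
  show ?thesis using assms(3)
  proof (cases rule: edges_cases)
    case (E x' y' a' b')
    define p q where "p = (x + s * y) div 2" "q = (y - s * x) div 2"
    define p' q' where "p' = (x' + s * y') div 2" "q' = (y' - s * x') div 2"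
    have x: "x = p - s * q" "y = q + s * p" using assms(1) E1(2) unfolding p_q_def by (auto; presburger)+
    have x': "x' = p' - s * q'" "y' = q' + s * p'" using assms(1) E(2) unfolding p'_q'_def by (auto; presburger)+
    have pp: "(x + s * y) div 2 = p" "(y - s * x) div 2 = q" "(x' + s * y') div 2 = p'" "(y' - s * x') div 2 = q'"
      by (simp_all add: p_q_def p'_q'_def)
    have s: "s = 1 \<or> s = -1" using assms(1) by simp
    have v: "a = 0 \<longleftrightarrow> a' = 0" using assms(5) unfolding E1(1) E(1) by simp
    note par = assms(4)[unfolded E1(1) E(1) parent.simps Let_def pp]
    have "a = a' \<and> b = b' \<and> p = p' \<and> q = q'"
    proof (cases "even (p + t + q)"; cases "even (p' + t + q')")
      assume "even (p + t + q)" "even (p' + t + q')"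
      then show ?thesis using par by simp
    next
      assume "even (p + t + q)" "odd (p' + t + q')"
      then have "a = - s * b'" using par by simp
      then show ?thesis using E1(3) E(3) v s by (elim disjE) simp_all
    next
      assume "odd (p + t + q)" "even (p' + t + q')"
      then have "- s * b = a'" using par by simp
      then show ?thesis using E1(3) E(3) v s by (elim disjE) simp_all
    next
      assume "odd (p + t + q)" "odd (p' + t + q')"
      then show ?thesis using par s by (elim disjE) simp_all
    qed
    then show ?thesis using x x' E1(1) E(1) by simp
  qed
qed

text \<open>The children \<open>?e1\<close> and \<open>?e2\<close> are based at the preimages of the
  even and the odd endpoint of \<open>e\<close> and point to a common odd vertex.\<close>

lemma parent_surj:
  assumes "s \<in> {1, -1}" "e \<in> edges"
  shows "\<exists>e'\<in>edges. parent s t e' = e \<and> vert e' = v"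
  using assms(2)
proof (cases rule: edges_cases)
  case (E x y a b)
  let ?e1 = "((x - t - s * y, y + s * (x - t)), (a, b))"
  let ?e2 = "((x + a - t - s * (y + b), y + b + s * (x + a - t)), (s * b, - s * a))"
  have "?e1 \<in> edges" "?e2 \<in> edges" using E assms(1) by (auto simp: edges_iff)
  moreover have "parent s t ?e1 = e"
  proof -
    have "(x - t - s * y + s * (y + s * (x - t))) div 2 = x - t"
      "(y + s * (x - t) - s * (x - t - s * y)) div 2 = y"
      using assms(1) by auto
    then show ?thesis using E by (simp add: Let_def)
  qed
  moreover have "parent s t ?e2 = e"
  proof -
    have "(x + a - t - s * (y + b) + s * (y + b + s * (x + a - t))) div 2 = x + a - t"
      "(y + b + s * (x + a - t) - s * (x + a - t - s * (y + b))) div 2 = y + b"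
      using assms(1) by auto
    then show ?thesis using E assms(1) by (auto simp: Let_def)
  qed
  moreover have "vert ?e1 \<longleftrightarrow> \<not> vert ?e2" using E(3) assms(1) by auto
  ultimately show ?thesis by metis
qed

text \<open>In Gaussian integers the direction is multiplied by \<open>\<sigma>\<close> times i: a
  left turn for \<open>\<sigma> = 1\<close>, a right turn for \<open>\<sigma> = -1\<close>.\<close>

definition turns :: "int \<Rightarrow> segment \<Rightarrow> segment \<Rightarrow> bool" where
  "turns \<sigma> c d \<longleftrightarrow> snd c = fst d \<and>
     direction d = (- \<sigma> * snd (direction c), \<sigma> * fst (direction c))"

text \<open>A coarse edge consists of a horizontal edge followed by a vertical one.\<close>

lemma siblings_turn:
  assumes "s \<in> {1, -1}" "e \<in> edges" "e' \<in> edges" "parent s t e = parent s t e'" "\<not> vert e" "vert e'"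
  shows "turns (if vert (parent s t e) then - s else s) (seg e) (seg e')"
  using assms(2)
proof (cases rule: edges_cases)
  case (E x y a b)
  note E1 = E
  show ?thesis using assms(3)
  proof (cases rule: edges_cases)
    case (E x' y' a' b')
    define p q where "p = (x + s * y) div 2" "q = (y - s * x) div 2"
    define p' q' where "p' = (x' + s * y') div 2" "q' = (y' - s * x') div 2"
    have x: "x = p - s * q" "y = q + s * p" using assms(1) E1(2) unfolding p_q_def by (auto; presburger)+
    have x': "x' = p' - s * q'" "y' = q' + s * p'" using assms(1) E(2) unfolding p'_q'_def by (auto; presburger)+
    have pp: "(x + s * y) div 2 = p" "(y - s * x) div 2 = q" "(x' + s * y') div 2 = p'" "(y' - s * x') div 2 = q'"
      by (simp_all add: p_q_def p'_q'_def)
    show ?thesis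
      using assms(1,4,5,6) E1(3) E(3) unfolding E1(1) E(1) turns_def direction_def parent.simps Let_def pp
      by (auto simp: x x' split: if_splits)
  qed
qed

text \<open>Consecutive coarse edges are perpendicular, so by \<open>siblings_turn\<close> the turns
  inside them are opposite. The two halves at the joint are thus rotated against their parents by
  the same 45 degrees, which preserves the turn.\<close>

lemma cousins_turn:
  assumes "s \<in> {1, -1}" "\<sigma> \<in> {1, -1}" "e \<in> edges" "e' \<in> edges" "vert e" "\<not> vert e'"
    "turns \<sigma> (seg (parent s t e)) (seg (parent s t e'))"
  shows "turns \<sigma> (seg e) (seg e')"
  using assms(3)
proof (cases rule: edges_cases)
  case (E x y a b)
  note E1 = E
  show ?thesis using assms(4)
  proof (cases rule: edges_cases)
    case (E x' y' a' b')
    define p q where "p = (x + s * y) div 2" "q = (y - s * x) div 2"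
    define p' q' where "p' = (x' + s * y') div 2" "q' = (y' - s * x') div 2"
    have x: "x = p - s * q" "y = q + s * p" using assms(1) E1(2) unfolding p_q_def by (auto; presburger)+
    have x': "x' = p' - s * q'" "y' = q' + s * p'" using assms(1) E(2) unfolding p'_q'_def by (auto; presburger)+
    have pp: "(x + s * y) div 2 = p" "(y - s * x) div 2 = q" "(x' + s * y') div 2 = p'" "(y' - s * x') div 2 = q'"
      by (simp_all add: p_q_def p'_q'_def)
    show ?thesis
      using assms(1,2,5,6,7) E1(3) E(3) unfolding E1(1) E(1) turns_def direction_def parent.simps Let_def pp
      by (auto simp: x x' split: if_splits)
  qed
qed

section \<open>Ancestors and positions within them\<close>

primrec ancestor :: "nat \<Rightarrow> (nat \<Rightarrow> int) \<Rightarrow> (nat \<Rightarrow> int) \<Rightarrow> edge \<Rightarrow> edge" where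
  "ancestor 0 s t e = e"
| "ancestor (Suc n) s t e = ancestor n (\<lambda>k. s (Suc k)) (\<lambda>k. t (Suc k)) (parent (s 0) (t 0) e)"

text \<open>The position of \<open>e\<close>, counted from 0, on the path of \<open>2 ^ n\<close>
  edges that its ancestor stands for. The last binary digit is \<open>vert e\<close> because the
  vertical child comes second.\<close>

primrec index :: "nat \<Rightarrow> (nat \<Rightarrow> int) \<Rightarrow> (nat \<Rightarrow> int) \<Rightarrow> edge \<Rightarrow> int" where
  "index 0 s t e = 0"
| "index (Suc n) s t e = of_bool (vert e) + 2 * index n (\<lambda>k. s (Suc k)) (\<lambda>k. t (Suc k)) (parent (s 0) (t 0) e)"

lemma parent_edges_signs: "signs s \<Longrightarrow> e \<in> edges \<Longrightarrow> parent (s k) t e \<in> edges"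
  unfolding signs_def by (rule parent_edges) blast

lemma ancestor_edges: "signs s \<Longrightarrow> e \<in> edges \<Longrightarrow> ancestor n s t e \<in> edges"
proof (induction n arbitrary: s t e)
  case (Suc n)
  then show ?case using Suc.IH[OF signs_Suc parent_edges_signs] by simp
qed simp

lemma index_nonneg: "0 \<le> index n s t e"
  by (induction n arbitrary: s t e) simp_all

lemma ancestor_add:
  "ancestor (n + m) s t e = ancestor m (\<lambda>k. s (n + k)) (\<lambda>k. t (n + k)) (ancestor n s t e)"
  by (induction n arbitrary: s t e) simp_all

lemma index_add:
  "index (n + m) s t e =
     index n s t e + 2 ^ n * index m (\<lambda>k. s (n + k)) (\<lambda>k. t (n + k)) (ancestor n s t e)"
  by (induction n arbitrary: s t e) (simp_all add: algebra_simps)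

lemma ancestor_index_inj:
  "\<lbrakk>signs s; e \<in> edges; e' \<in> edges; ancestor n s t e = ancestor n s t e'; index n s t e = index n s t e'\<rbrakk>
     \<Longrightarrow> e = e'"
proof (induction n arbitrary: s t e e')
  case (Suc n)
  let ?i = "\<lambda>e. index n (\<lambda>k. s (Suc k)) (\<lambda>k. t (Suc k)) (parent (s 0) (t 0) e)"
  have eq: "of_bool (vert e) + 2 * ?i e = of_bool (vert e') + 2 * ?i e'" using Suc.prems(5) by simp
  then have "vert e = vert e'" by (cases "vert e"; cases "vert e'"; simp; presburger)
  moreover from this have "?i e = ?i e'" using eq by simp
  then have "parent (s 0) (t 0) e = parent (s 0) (t 0) e'"
    using Suc.IH[where t = "\<lambda>k. t (Suc k)", OF signs_Suc[OF Suc.prems(1)]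
        parent_edges_signs[OF Suc.prems(1,2)] parent_edges_signs[OF Suc.prems(1,3)]] Suc.prems(4)
    by simp
  moreover have "s 0 \<in> {1, -1}" using Suc.prems(1) by (simp add: signs_def)
  ultimately show ?case by (intro parent_inj[OF _ Suc.prems(2,3)])
qed simp

lemma ancestor_index_surj:
  "\<lbrakk>signs s; p \<in> edges; 0 \<le> i; i < 2 ^ n\<rbrakk> \<Longrightarrow> \<exists>e\<in>edges. ancestor n s t e = p \<and> index n s t e = i"
proof (induction n arbitrary: s t i)
  case (Suc n)
  have "i div 2 < 2 ^ n" using Suc.prems(4) by simp
  then obtain f where f: "f \<in> edges" "ancestor n (\<lambda>k. s (Suc k)) (\<lambda>k. t (Suc k)) f = p"
    "index n (\<lambda>k. s (Suc k)) (\<lambda>k. t (Suc k)) f = i div 2"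
    using Suc.IH[of "\<lambda>k. s (Suc k)" "i div 2" "\<lambda>k. t (Suc k)"] Suc.prems signs_Suc[of s] by auto
  have "s 0 \<in> {1, -1}" using Suc.prems(1) by (simp add: signs_def)
  then obtain e where e: "e \<in> edges" "parent (s 0) (t 0) e = f" "vert e = odd i"
    using parent_surj[of "s 0" f "t 0" "odd i"] f(1) by blast
  have "index (Suc n) s t e = i" using e(2,3) f(3) by (simp add: of_bool_odd_eq_mod_2)
  then show ?case using e f by auto
qed simp

text \<open>If the index of \<open>e'\<close> is odd, the edges are siblings, and the orientation of
  their parent is the next binary digit, which decides the class modulo 4. If it is even, the turn
  is inherited from the parents, as in the recursion of \<open>toeplitz\<close>. Reading the extra
  digit costs one level, hence \<open>n - 1\<close>.\<close>

lemma consecutive_turn: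
  "\<lbrakk>signs s; e \<in> edges; e' \<in> edges; ancestor n s t e = ancestor n s t e'; index n s t e' = index n s t e + 1\<rbrakk>
     \<Longrightarrow> \<exists>\<sigma>\<in>{1, -1}. turns \<sigma> (seg e) (seg e') \<and>
           (toeplitz (n - 1) s (index n s t e') \<noteq> 0 \<longrightarrow> \<sigma> = toeplitz (n - 1) s (index n s t e'))"
proof (induction n arbitrary: s t e e')
  case (Suc n)
  let ?s = "\<lambda>k. s (Suc k)" and ?t = "\<lambda>k. t (Suc k)"
  define f f' where ff: "f = parent (s 0) (t 0) e" "f' = parent (s 0) (t 0) e'"
  have s0: "s 0 \<in> {1, -1}" using Suc.prems(1) by (simp add: signs_def)
  have f: "f \<in> edges" "f' \<in> edges" "signs ?s"
    using Suc.prems by (simp_all add: ff parent_edges_signs signs_Suc)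
  have anc: "ancestor n ?s ?t f = ancestor n ?s ?t f'" using Suc.prems(4) by (simp add: ff)
  have idx: "of_bool (vert e') + 2 * index n ?s ?t f' = of_bool (vert e) + 2 * index n ?s ?t f + 1"
    using Suc.prems(5) by (simp add: ff)
  show ?case
  proof (cases "vert e'")
    case True
    then have e: "\<not> vert e" using idx by (cases "vert e"; simp; presburger)
    then have "index n ?s ?t f' = index n ?s ?t f" using idx True by simp
    then have "f = f'" using ancestor_index_inj[OF f(3,1,2) anc] by simp
    then have turn: "turns (if vert f then - s 0 else s 0) (seg e) (seg e')"
      using siblings_turn[OF s0 Suc.prems(2,3) _ e True] by (simp add: ff)
    have "toeplitz n s (index (Suc n) s t e') = (if vert f then - s 0 else s 0)"
      if "toeplitz n s (index (Suc n) s t e') \<noteq> 0"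
    proof (cases n)
      case (Suc m)
      define j where "j = index m (\<lambda>k. s (Suc (Suc k))) (\<lambda>k. t (Suc (Suc k))) (parent (s 1) (t 1) f)"
      have "index (Suc n) s t e' = 1 + 2 * (of_bool (vert f) + 2 * j)"
        using True \<open>f = f'\<close> by (simp add: Suc ff j_def)
      then show ?thesis by (cases "vert f") (simp_all add: Suc; presburger)+
    qed (use that in simp)
    then show ?thesis using turn s0 by (intro bexI[of _ "if vert f then - s 0 else s 0"]) auto
  next
    case False
    then have e: "vert e" using idx by (cases "vert e"; simp; presburger)
    then have step: "index n ?s ?t f' = index n ?s ?t f + 1" using idx False by simp
    then obtain m where m: "n = Suc m" by (cases n) auto
    obtain \<sigma> where \<sigma>: "\<sigma> \<in> {1, -1}" "turns \<sigma> (seg f) (seg f')"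
      "toeplitz (n - 1) ?s (index n ?s ?t f') \<noteq> 0 \<Longrightarrow> \<sigma> = toeplitz (n - 1) ?s (index n ?s ?t f')"
      using Suc.IH[OF f(3,1,2) anc step] by blast
    have "turns \<sigma> (seg e) (seg e')"
      using cousins_turn[OF s0 \<sigma>(1) Suc.prems(2,3) e False] \<sigma>(2) by (simp add: ff)
    moreover have "toeplitz (Suc n - 1) s (index (Suc n) s t e') = toeplitz (n - 1) ?s (index n ?s ?t f')"
      using False by (simp add: m ff)
    ultimately show ?thesis using \<sigma>(1,3) by metis
  qed
qed simp

section \<open>Supports of encoded edges\<close>

lemma support_seg:
  "support (seg ((x, y), (a, b))) = closed_segment (pt (x, y)) (pt (x + a, y + b))"
  by (simp add: support_def insert_commute closed_segment_commute[of "pt (x, y + b)"])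

lemma support_seg_inj:
  assumes "e \<in> edges" "e' \<in> edges" "support (seg e) = support (seg e')"
  shows "e = e'"
  using assms(1)
proof (cases rule: edges_cases)
  case (E x y a b)
  note E1 = E
  show ?thesis using assms(2)
  proof (cases rule: edges_cases)
    case (E x' y' a' b')
    have "{pt (x, y), pt (x + a, y + b)} = {pt (x', y'), pt (x' + a', y' + b')}"
      using assms(3) unfolding E1(1) E(1) support_seg by (simp add: closed_segment_eq)
    then have "(x = x' \<and> y = y' \<and> x + a = x' + a' \<and> y + b = y' + b') \<or>
      (x = x' + a' \<and> y = y' + b' \<and> x + a = x' \<and> y + b = y')"
      by (auto simp: doubleton_eq_iff pt_def)
    then show ?thesis
    proof
      \<comment> \<open>Exchanged endpoints are impossible: both base points are even, yet they
        would differ by a unit vector.\<close>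
      assume "x = x' + a' \<and> y = y' + b' \<and> x + a = x' \<and> y + b = y'"
      then have "x + y = (x' + y') + (a' + b')" by simp
      moreover have "odd (a' + b')" using E(3) by auto
      ultimately have False using E1(2) E(2) by (metis odd_add)
      then show ?thesis ..
    qed (use E1(1) E(1) in simp)
  qed
qed

lemma seg_is_segment: "e \<in> edges \<Longrightarrow> is_segment (seg e)"
  by (cases rule: edges_cases, assumption) (auto simp: is_segment_def direction_def)

lemma grid_edge:
  assumes "a = 1 \<and> b = 0 \<or> a = 0 \<and> b = 1"
  shows "\<exists>e\<in>edges. support (seg e) = closed_segment (pt (x, y)) (pt (x + a, y + b))"
proof (cases "even (x + y)")
  case True
  then have "((x, y), (a, b)) \<in> edges" using assms by (auto simp: edges_iff)
  then show ?thesis using support_seg by blast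
next
  case False
  have "support (seg ((x + a, y + b), (- a, - b))) = closed_segment (pt (x + a, y + b)) (pt (x, y))"
    using support_seg[of "x + a" "y + b" "- a" "- b"] by simp
  moreover have "((x + a, y + b), (- a, - b)) \<in> edges"
    using assms False by (auto simp: edges_iff)
  ultimately show ?thesis using closed_segment_commute by metis
qed

text \<open>Above a common ancestor both indices receive the same higher digits.\<close>

lemma ancestor_merge_mono:
  assumes "ancestor n s t e = ancestor n s t e'" "n \<le> m"
  shows "ancestor m s t e = ancestor m s t e'"
    and "index m s t e - index m s t e' = index n s t e - index n s t e'"
proof -
  obtain j where m: "m = n + j" using assms(2) le_Suc_ex by blast
  show "ancestor m s t e = ancestor m s t e'" unfolding m ancestor_add assms(1) ..
  show "index m s t e - index m s t e' = index n s t e - index n s t e'"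
    unfolding m index_add assms(1) by simp
qed

lemma index_Suc_right: "index (Suc n) s t e = index n s t e + 2 ^ n * of_bool (vert (ancestor n s t e))"
  using index_add[of n 1 s t e] by simp

text \<open>The two quantities count the edges of the ancestor before \<open>e\<close> and those
  from \<open>e\<close> on. A new top digit enlarges one of them.\<close>

lemma index_mono:
  assumes "n \<le> m"
  shows "index n s t e \<le> index m s t e" "2 ^ n - index n s t e \<le> 2 ^ m - index m s t e"
proof -
  show "index n s t e \<le> index m s t e"
    by (rule lift_Suc_mono_le[OF _ assms]) (simp add: index_Suc_right del: index.simps)
  show "2 ^ n - index n s t e \<le> 2 ^ m - index m s t e"
    by (rule lift_Suc_mono_le[OF _ assms]) (simp add: index_Suc_right del: index.simps)
qed

lemma index_unbounded:
  assumes "\<And>m. \<exists>k\<ge>m. vert (ancestor k s t e)"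
  shows "\<exists>n. int K \<le> index n s t e"
proof (induction K)
  case 0
  then show ?case using index_nonneg by auto
next
  case (Suc K)
  then obtain n where n: "int K \<le> index n s t e" by blast
  obtain k where k: "n \<le> k" "vert (ancestor k s t e)" using assms by blast
  have "index (Suc k) s t e = index k s t e + 2 ^ k" using k(2) by (simp add: index_Suc_right del: index.simps)
  moreover have "(1::int) \<le> 2 ^ k" by simp
  ultimately have "int (Suc K) \<le> index (Suc k) s t e" using n index_mono(1)[OF k(1), of s t e] by linarith
  then show ?case by blast
qed

lemma coindex_unbounded:
  assumes "\<And>m. \<exists>k\<ge>m. \<not> vert (ancestor k s t e)"
  shows "\<exists>n. int K \<le> 2 ^ n - index n s t e"
proof (induction K)
  case 0
  then show ?case by (intro exI[of _ 0]) simp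
next
  case (Suc K)
  then obtain n where n: "int K \<le> 2 ^ n - index n s t e" by blast
  obtain k where k: "n \<le> k" "\<not> vert (ancestor k s t e)" using assms by blast
  have "2 ^ Suc k - index (Suc k) s t e = 2 ^ k - index k s t e + 2 ^ k"
    using k(2) by (simp add: index_Suc_right del: index.simps)
  moreover have "(1::int) \<le> 2 ^ k" by simp
  ultimately have "int (Suc K) \<le> 2 ^ Suc k - index (Suc k) s t e"
    using n index_mono(2)[OF k(1), of s t e] by linarith
  then show ?case by blast
qed

lemma turns_associated:
  assumes "is_segment c" "turns \<sigma> c d" "\<sigma> \<in> {1, -1}"
  shows "snd c = fst d" "orthogonal (pt (direction c)) (pt (direction d))"
    "(if left_turn c d then 1 else -1) = \<sigma>"
  using assms by (auto simp: turns_def is_segment_def left_turn_def orthogonal_def pt_def inner_prod_def)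

text \<open>The recurrence of both orientations among the ancestors of \<open>e0\<close> makes the curve infinite in
  both directions: the orientations are the binary digits of the position of \<open>e0\<close> in its
  ancestors.\<close>

lemma curve_of_ancestors:
  assumes s: "signs s" and e0: "e0 \<in> edges"
    and merge: "\<And>e. e \<in> edges \<Longrightarrow> \<exists>n. ancestor n s t e = ancestor n s t e0"
    and recur: "\<And>m v. \<exists>k\<ge>m. vert (ancestor k s t e0) = v"
  shows "\<exists>D. complete_curve D \<and> folding_type s (associated_sequence D) \<and> covers_plane D"
proof -
  define lev where "lev e = (SOME n. ancestor n s t e = ancestor n s t e0)" for e
  \<comment> \<open>The signed number of steps along the curve from \<open>e0\<close>; every level
    with a common ancestor gives the same value.\<close>
  define pos where "pos e = index (lev e) s t e - index (lev e) s t e0" for e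
  have lev: "ancestor (lev e) s t e = ancestor (lev e) s t e0" if "e \<in> edges" for e
    unfolding lev_def by (rule someI_ex[OF merge[OF that]])
  have pos: "pos e = index n s t e - index n s t e0"
    if "e \<in> edges" "ancestor n s t e = ancestor n s t e0" for e n
  proof -
    have "pos e = index (max n (lev e)) s t e - index (max n (lev e)) s t e0"
      unfolding pos_def by (rule ancestor_merge_mono(2)[OF lev[OF that(1)], symmetric]) simp
    also have "\<dots> = index n s t e - index n s t e0"
      by (rule ancestor_merge_mono(2)[OF that(2)]) simp
    finally show ?thesis .
  qed
  have common: "\<exists>n\<ge>m. ancestor n s t e = ancestor n s t e0 \<and> ancestor n s t e' = ancestor n s t e0"
    if "e \<in> edges" "e' \<in> edges" for e e' m
    using ancestor_merge_mono(1)[OF lev[OF that(1)], of "max m (max (lev e) (lev e'))"]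
      ancestor_merge_mono(1)[OF lev[OF that(2)], of "max m (max (lev e) (lev e'))"]
    by (intro exI[of _ "max m (max (lev e) (lev e'))"]) simp
  have inj: "inj_on pos edges"
  proof (rule inj_onI)
    fix e e' assume e: "e \<in> edges" "e' \<in> edges" and eq: "pos e = pos e'"
    obtain n where n: "ancestor n s t e = ancestor n s t e0" "ancestor n s t e' = ancestor n s t e0"
      using common[OF e] by blast
    then have "index n s t e = index n s t e'" using eq pos[OF e(1) n(1)] pos[OF e(2) n(2)] by simp
    then show "e = e'" using n by (intro ancestor_index_inj[OF s e, of n t]) metis+
  qed
  have surj: "\<exists>e\<in>edges. pos e = k" for k
  proof -
    have v: "\<exists>j\<ge>m. vert (ancestor j s t e0)" "\<exists>j\<ge>m. \<not> vert (ancestor j s t e0)" for m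
      using recur[of m True] recur[of m False] by simp_all
    obtain n1 where n1: "\<bar>k\<bar> \<le> index n1 s t e0"
      using index_unbounded[OF v(1), of "nat \<bar>k\<bar>"] by auto
    obtain n2 where n2: "\<bar>k\<bar> + 1 \<le> 2 ^ n2 - index n2 s t e0"
      using coindex_unbounded[OF v(2), of "nat (\<bar>k\<bar> + 1)"] by auto
    define n where "n = max n1 n2"
    have "0 \<le> index n s t e0 + k" "index n s t e0 + k < 2 ^ n"
      using n1 n2 index_mono(1)[of n1 n s t e0] index_mono(2)[of n2 n s t e0] by (auto simp: n_def)
    then obtain e where e: "e \<in> edges" "ancestor n s t e = ancestor n s t e0" "index n s t e = index n s t e0 + k"
      using ancestor_index_surj[OF s ancestor_edges[OF s e0]] by blast
    then show ?thesis using pos[OF e(1,2)] by auto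
  qed
  define E where "E k = inv_into edges pos k" for k
  define D where "D k = seg (E k)" for k
  have range: "k \<in> pos ` edges" for k using surj by (metis imageI)
  have E: "E k \<in> edges" "pos (E k) = k" for k
    unfolding E_def using range[of k] by (simp_all add: inv_into_into f_inv_into_f)
  have E_pos: "E (pos e) = e" if "e \<in> edges" for e
    unfolding E_def using inj that by simp
  \<comment> \<open>The turn from edge \<open>i\<close> to edge \<open>i + 1\<close> is read at the
    index of the second edge, hence the 1. At level \<open>n\<close> only the lowest
    \<open>Suc n\<close> digits of the index of \<open>e0\<close> matter, so the shift is
    independent of \<open>N\<close>.\<close>
  have step: "\<exists>\<sigma>\<in>{1, -1}. turns \<sigma> (D i) (D (i + 1)) \<and>
      (toeplitz n s (i + (1 + index (Suc n) s t e0)) \<noteq> 0 \<longrightarrow>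
       \<sigma> = toeplitz n s (i + (1 + index (Suc n) s t e0)))" for i n
  proof -
    obtain N where N: "Suc n \<le> N" "ancestor N s t (E i) = ancestor N s t e0"
      "ancestor N s t (E (i + 1)) = ancestor N s t e0" using common[OF E(1) E(1)] by blast
    have idx: "index N s t (E i) = i + index N s t e0"
      "index N s t (E (i + 1)) = i + 1 + index N s t e0"
      using pos[OF E(1) N(2)] pos[OF E(1) N(3)] E(2) by simp_all
    obtain \<sigma> where \<sigma>: "\<sigma> \<in> {1, -1}" "turns \<sigma> (D i) (D (i + 1))"
      "toeplitz (N - 1) s (i + 1 + index N s t e0) \<noteq> 0 \<Longrightarrow> \<sigma> = toeplitz (N - 1) s (i + 1 + index N s t e0)"
      using consecutive_turn[OF s E(1) E(1), of N t i "i + 1"] N idx unfolding D_def by auto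
    obtain j where j: "N = Suc n + j" using N(1) le_Suc_ex by blast
    have "toeplitz n s ((i + 1) + index N s t e0) = toeplitz n s ((i + 1) + index (Suc n) s t e0)"
      by (rule toeplitz_periodic_mod) (simp add: j index_add del: add_Suc index.simps)
    then have "toeplitz (N - 1) s (i + 1 + index N s t e0) = toeplitz n s (i + (1 + index (Suc n) s t e0))"
      if "toeplitz n s (i + (1 + index (Suc n) s t e0)) \<noteq> 0"
      using that toeplitz_add[of n s "i + 1 + index N s t e0" j] j by (simp add: add.assoc)
    then show ?thesis using \<sigma> by metis
  qed
  have seg: "is_segment (D i)" for i unfolding D_def using seg_is_segment[OF E(1)] .
  have turn: "snd (D i) = fst (D (i + 1)) \<and> orthogonal (pt (direction (D i))) (pt (direction (D (i + 1))))" for i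
  proof -
    obtain \<sigma> where "\<sigma> \<in> {1, -1}" "turns \<sigma> (D i) (D (i + 1))" using step[of i 0] by blast
    then show ?thesis using turns_associated(1,2)[OF seg] by blast
  qed
  have supp_inj: "i = j" if "support (D i) = support (D j)" for i j
  proof -
    have "E i = E j" using support_seg_inj[OF E(1) E(1)] that unfolding D_def by blast
    then show ?thesis using E(2) by metis
  qed
  have curve: "complete_curve D"
    unfolding complete_curve_def using seg turn supp_inj by blast
  have "folding_type s (associated_sequence D)"
    unfolding folding_type_def
  proof
    fix n
    have "associated_sequence D i = toeplitz n s (i + (1 + index (Suc n) s t e0))"
      if nz: "toeplitz n s (i + (1 + index (Suc n) s t e0)) \<noteq> 0" for i
    proof -
      obtain \<sigma> where "\<sigma> \<in> {1, -1}" "turns \<sigma> (D i) (D (i + 1))"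
        "\<sigma> = toeplitz n s (i + (1 + index (Suc n) s t e0))" using step[of i n] nz by blast
      then show ?thesis using turns_associated(3)[OF seg] unfolding associated_sequence_def by metis
    qed
    then show "\<exists>r. \<forall>k. toeplitz n s (k + r) \<noteq> 0 \<longrightarrow> associated_sequence D k = toeplitz n s (k + r)"
      by blast
  qed
  moreover have cover: "\<exists>!i. support (D i) = closed_segment (pt (x, y)) (pt (x + a, y + b))"
    if ab: "a = 1 \<and> b = 0 \<or> a = 0 \<and> b = 1" for x y a b
  proof -
    obtain e where "e \<in> edges" "support (seg e) = closed_segment (pt (x, y)) (pt (x + a, y + b))"
      using grid_edge[OF ab] by blast
    then have "support (D (pos e)) = closed_segment (pt (x, y)) (pt (x + a, y + b))"
      by (simp add: D_def E_pos)
    then show ?thesis using supp_inj by metis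
  qed
  have "covers_plane D"
    unfolding covers_plane_def using cover[of 1 0] cover[of 0 1] by simp
  ultimately show ?thesis using curve by blast
qed

section \<open>Merging two edges\<close>

text \<open>An offset consists of the vector between the even endpoints of two edges and their two unit
  vectors. In \<open>move s i\<close>, the parity \<open>i\<close> of the first image endpoint is at our disposal through the
  translation \<open>t\<close>, whereas \<open>s\<close> is prescribed.\<close>

type_synonym offset = "int \<times> int \<times> int \<times> int \<times> int \<times> int"

fun offset :: "edge \<Rightarrow> edge \<Rightarrow> offset" where
  "offset ((x, y), (a, b)) ((x', y'), (c, d)) = (x' - x, y' - y, a, b, c, d)"

fun move :: "int \<Rightarrow> bool \<Rightarrow> offset \<Rightarrow> offset" where
  "move s i (x, y, a, b, c, d) =
     (let p = (x + s * y) div 2; q = (y - s * x) div 2; j = (i \<noteq> odd (p + q)) in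
      (p + (if j then s * d else 0) - (if i then s * b else 0),
       q - (if j then s * c else 0) + (if i then s * a else 0),
       (if i then - s * b else a), (if i then s * a else b),
       (if j then - s * d else c), (if j then s * c else d)))"

text \<open>The translations may depend on all of \<open>s\<close>, but every \<open>s\<close> is
  included because merging will be applied to tails of the given signs.\<close>

definition merges :: "offset \<Rightarrow> bool" where
  "merges S \<longleftrightarrow> (\<forall>s e e'. signs s \<longrightarrow> e \<in> edges \<longrightarrow> e' \<in> edges \<longrightarrow> offset e e' = S \<longrightarrow>
     (\<exists>n t. ancestor n s t e = ancestor n s t e'))"

lemma parent_move:
  assumes "s \<in> {1, -1}" "e \<in> edges" "e' \<in> edges"
  shows "\<exists>t. offset (parent s t e) (parent s t e') = move s i (offset e e')"
  using assms(2)
proof (cases rule: edges_cases)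
  case (E x y a b)
  note E1 = E
  show ?thesis using assms(3)
  proof (cases rule: edges_cases)
    case (E x' y' c d)
    define p q where "p = (x + s * y) div 2" "q = (y - s * x) div 2"
    define p' q' where "p' = (x' - x + s * (y' - y)) div 2" "q' = (y' - y - s * (x' - x)) div 2"
    have pq: "(x + s * y) div 2 = p" "(y - s * x) div 2 = q"
      "(x' - x + s * (y' - y)) div 2 = p'" "(y' - y - s * (x' - x)) div 2 = q'"
      by (simp_all add: p_q_def p'_q'_def)
    have s: "s = 1 \<or> s = -1" using assms(1) by simp
    have pq': "(x' + s * y') div 2 = p + p'" "(y' - s * x') div 2 = q + q'"
      using s E1(2) E(2) unfolding p_q_def p'_q'_def by (elim disjE; simp; presburger)+
    \<comment> \<open>Gives the first image the parity \<open>i\<close>. The translation cancels in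
      the offset, so the second parity follows from \<open>p' + q'\<close>.\<close>
    define t where "t = p + q + of_bool i"
    have t: "even (p + t + q) \<longleftrightarrow> \<not> i"
      unfolding t_def by (cases i) simp_all
    have t': "even (p + p' + t + (q + q')) \<longleftrightarrow> \<not> (i \<noteq> odd (p' + q'))"
    proof -
      have "p + p' + t + (q + q') = (p + t + q) + (p' + q')" by simp
      then show ?thesis using t by (simp only: even_add) blast
    qed
    have "offset (parent s t e) (parent s t e') = move s i (offset e e')"
      unfolding E1(1) E(1) parent.simps offset.simps move.simps Let_def pq pq' t t'
      by (cases i; cases "odd (p' + q')") simp_all
    then show ?thesis by blast
  qed
qed

lemma merges_same: "merges (0, 0, a, b, a, b)"
  unfolding merges_def
proof (intro allI impI)
  fix s e e' assume "e \<in> edges" "e' \<in> edges" "offset e e' = (0, 0, a, b, a, b)"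
  then have "e = e'" by (cases e; cases "fst e"; cases "snd e"; cases e'; cases "fst e'"; cases "snd e'") simp
  then show "\<exists>n t. ancestor n s t e = ancestor n s t e'" by blast
qed

text \<open>One round of a game: the sign is given, a parity is the answer, and the remaining
  translations come from the new offset.\<close>

lemma merges_move:
  assumes "\<And>s. s \<in> {1, -1} \<Longrightarrow> \<exists>i. merges (move s i S)"
  shows "merges S"
  unfolding merges_def
proof (intro allI impI)
  fix s e e' assume s: "signs s" and e: "e \<in> edges" "e' \<in> edges" and off: "offset e e' = S"
  have s0: "s 0 \<in> {1, -1}" using s by (simp add: signs_def)
  obtain i where i: "merges (move (s 0) i S)" using assms[OF s0] by blast
  obtain t0 where t0: "offset (parent (s 0) t0 e) (parent (s 0) t0 e') = move (s 0) i S"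
    using parent_move[OF s0 e] off by blast
  obtain n t where "ancestor n (\<lambda>k. s (Suc k)) t (parent (s 0) t0 e) = ancestor n (\<lambda>k. s (Suc k)) t (parent (s 0) t0 e')"
    using i signs_Suc[OF s] parent_edges[OF s0 e(1)] parent_edges[OF s0 e(2)] t0 unfolding merges_def by blast
  then have "ancestor (Suc n) s (case_nat t0 t) e = ancestor (Suc n) s (case_nat t0 t) e'" by simp
  then show "\<exists>n t. ancestor n s t e = ancestor n s t e'" by blast
qed

text \<open>Game search: within \<open>n\<close> rounds, whatever the signs, suitable parities lead
  to \<open>P\<close>. The conditionals stand for disjunctions and let evaluation skip the second
  branch.\<close>

primrec forces :: "(offset \<Rightarrow> bool) \<Rightarrow> nat \<Rightarrow> offset \<Rightarrow> bool" where
  "forces P 0 S \<longleftrightarrow> P S"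
| "forces P (Suc n) S \<longleftrightarrow> P S \<or>
     ((if forces P n (move 1 False S) then True else forces P n (move 1 True S)) \<and>
      (if forces P n (move (-1) False S) then True else forces P n (move (-1) True S)))"

lemma forces_merges:
  assumes "\<And>S. P S \<Longrightarrow> merges S"
  shows "forces P n S \<Longrightarrow> merges S"
proof (induction n arbitrary: S)
  case (Suc n)
  show ?case
  proof (cases "P S")
    case False
    have "\<exists>i. merges (move s i S)" if "s \<in> {1, -1}" for s
    proof -
      have "forces P n (move s False S) \<or> forces P n (move s True S)"
        using that Suc.prems False by (auto split: if_splits)
      then show ?thesis using Suc.IH by metis
    qed
    then show ?thesis by (rule merges_move)
  qed (rule assms)
qed (simp add: assms)

fun norm2 :: "offset \<Rightarrow> int" where
  "norm2 (x, y, a, b, c, d) = x * x + y * y"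

fun merged :: "offset \<Rightarrow> bool" where
  "merged (x, y, a, b, c, d) \<longleftrightarrow> x = 0 \<and> y = 0 \<and> a = c \<and> b = d"

abbreviation units :: "(int \<times> int) list" where
  "units \<equiv> [(1, 0), (-1, 0), (0, 1), (0, -1)]"

text \<open>These are all integer vectors of squared length 10. One round need not shorten them, two
  rounds can.\<close>

lemma forces_10:
  "list_all (\<lambda>(x, y). list_all (\<lambda>(a, b). list_all (\<lambda>(c, d). forces (\<lambda>S. norm2 S < 10) 2 (x, y, a, b, c, d)) units) units)
    [(3, 1), (3, -1), (-3, 1), (-3, -1), (1, 3), (1, -3), (-1, 3), (-1, -3)]"
  by code_simp

lemma forces_0:
  "list_all (\<lambda>(a, b). list_all (\<lambda>(c, d). forces merged 5 (0, 0, a, b, c, d)) units) units"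
  by code_simp

lemma forces_2:
  "list_all (\<lambda>(x, y). list_all (\<lambda>(a, b). list_all (\<lambda>(c, d). forces merged 5 (x, y, a, b, c, d)) units) units)
    [(1, 1), (1, -1), (-1, 1), (-1, -1)]"
  by code_simp

lemma merges_invalid:
  assumes "\<not> (even (x + y) \<and> (a, b) \<in> set units \<and> (c, d) \<in> set units)"
  shows "merges (x, y, a, b, c, d)"
  using assms unfolding merges_def by (auto simp: edges_def)

lemma square_sum_gt_2:
  fixes p q r :: int
  assumes "3 \<le> \<bar>p\<bar> \<or> 3 \<le> \<bar>q\<bar>" "r \<in> {1, -1}"
  shows "2 < (p + r) * (p + r) + q * q"
proof -
  have sq: "4 \<le> z * z" if "2 \<le> \<bar>z\<bar>" for z :: int
    using mult_mono[OF that that] by simp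
  have "2 \<le> \<bar>p + r\<bar> \<or> 2 \<le> \<bar>q\<bar>" using assms by auto
  then show ?thesis using sq[of "p + r"] sq[of q] zero_le_square[of "p + r"] zero_le_square[of q] by linarith
qed

text \<open>For odd coordinates only the second edge is rotated, which displaces the image vector by
  a unit vector. A displacement \<open>r\<close> along the first axis lowers the squared length by
  \<open>(p - r) * (p - r) + q * q - 2\<close>, and similarly for the second axis;
  \<open>square_sum_gt_2\<close> makes this positive.\<close>

lemma move_shrinks:
  fixes x y :: int
  assumes "odd x" "odd y" "6 \<le> \<bar>x\<bar> + \<bar>y\<bar>" "s \<in> {1, -1}" "(c, d) \<in> set units"
  shows "norm2 (move s False (x, y, a, b, c, d)) < x * x + y * y"
proof -
  define p q where "p = (x + s * y) div 2" "q = (y - s * x) div 2"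
  have s: "s = 1 \<or> s = -1" using assms(4) by simp
  have xy: "x = p - s * q" "y = q + s * p" using s assms(1,2) unfolding p_q_def by (elim disjE; simp; presburger)+
  have odd: "odd (p + q)"
  proof -
    have "p + q = (if s = 1 then y else x)" using s xy by (elim disjE) simp_all
    then show ?thesis using assms(1,2) by simp
  qed
  \<comment> \<open>The sum of \<open>\<bar>x\<bar>\<close> and \<open>\<bar>y\<bar>\<close> is
    twice the maximum of \<open>\<bar>p\<bar>\<close> and \<open>\<bar>q\<bar>\<close>.\<close>
  have big: "3 \<le> \<bar>p\<bar> \<or> 3 \<le> \<bar>q\<bar>" using assms(3) s unfolding xy by (elim disjE) auto
  then have big': "3 \<le> \<bar>q\<bar> \<or> 3 \<le> \<bar>p\<bar>" by blast
  have sum: "x * x + y * y = 2 * (p * p + q * q)" using s unfolding xy by (elim disjE) (simp_all add: algebra_simps)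
  have "norm2 (move s False (x, y, a, b, c, d)) = (p + s * d) * (p + s * d) + (q - s * c) * (q - s * c)"
    using odd by (simp add: Let_def p_q_def)
  also have "\<dots> < 2 * (p * p + q * q)"
    using square_sum_gt_2[OF big, of 1] square_sum_gt_2[OF big, of "-1"]
      square_sum_gt_2[OF big', of 1] square_sum_gt_2[OF big', of "-1"] s assms(5)
    by (auto simp: algebra_simps)
  finally show ?thesis using sum by simp
qed

text \<open>Not rotating the first edge halves the squared distance when the endpoint vector is nonzero with
  even coordinates, and decreases it for odd coordinates unless it is 2 or 10. These two values and 0
  are settled by exhaustive search.\<close>

lemma merges_all: "merges S"
proof (induction "nat (norm2 S)" arbitrary: S rule: less_induct)
  case less
  obtain x y a b c d where S: "S = (x, y, a, b, c, d)" by (metis prod_cases6)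
  have IH: "merges S'" if "norm2 S' < x * x + y * y" for S'
  proof (rule less)
    have "0 \<le> norm2 S'" by (cases S') simp
    then show "nat (norm2 S') < nat (norm2 S)" using that S by simp
  qed
  show ?case
  proof (cases "even (x + y) \<and> (a, b) \<in> set units \<and> (c, d) \<in> set units")
    case False
    then show ?thesis unfolding S by (rule merges_invalid)
  next
    case valid: True
    have merged: "merges S'" if "merged S'" for S'
      using that merges_same by (cases S') auto
    consider "x = 0" "y = 0" | "even x" "even y" "x \<noteq> 0 \<or> y \<noteq> 0"
      | "odd x" "odd y" "6 \<le> \<bar>x\<bar> + \<bar>y\<bar>" | "odd x" "odd y" "\<bar>x\<bar> + \<bar>y\<bar> < 6"
      using valid by fastforce
    then show ?thesis
    proof cases
      case 1
      then have "forces merged 5 S" using forces_0 valid unfolding S list_all_iff by fast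
      then show ?thesis using forces_merges[of merged] merged by blast
    next
      case 2
      obtain x' y' where xy: "x = 2 * x'" "y = 2 * y'" using 2 by blast
      have "norm2 (move s False S) < x * x + y * y" if "s \<in> {1, -1}" for s
      proof -
        have s: "s = 1 \<or> s = -1" using that by simp
        have pq: "(x + s * y) div 2 = x' + s * y'" "(y - s * x) div 2 = y' - s * x'"
          using s unfolding xy by (elim disjE; simp; presburger)+
        have "x' + s * y' + (y' - s * x') = 2 * (if s = 1 then y' else x')"
          using s by (elim disjE) simp_all
        then have "\<not> odd (x' + s * y' + (y' - s * x'))" by simp
        then have "norm2 (move s False S) = (x' + s * y') * (x' + s * y') + (y' - s * x') * (y' - s * x')"
          unfolding S move.simps Let_def pq by (simp only: if_False norm2.simps) simp
        also have "\<dots> = 2 * (x' * x' + y' * y')"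
          using s by (elim disjE) (simp_all add: algebra_simps)
        finally have eq: "norm2 (move s False S) = 2 * (x' * x' + y' * y')" .
        have "0 < x' * x' + y' * y'" using 2(3) xy by (simp add: sum_squares_gt_zero_iff)
        then show ?thesis unfolding eq unfolding xy by simp
      qed
      then show ?thesis using IH by (intro merges_move) blast
    next
      case 3
      then have "norm2 (move s False S) < x * x + y * y" if "s \<in> {1, -1}" for s
        using move_shrinks that valid unfolding S by blast
      then show ?thesis using IH by (intro merges_move) blast
    next
      case 4
      \<comment> \<open>Two odd absolute values have an even sum, so below 6 it is at most
        4.\<close>
      then have "x \<in> {-1, 1} \<and> y \<in> {-1, 1} \<or> x \<in> {-3, 3} \<and> y \<in> {-1, 1} \<or> x \<in> {-1, 1} \<and> y \<in> {-3, 3}"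
        by (simp; presburger)
      then consider "(x, y) \<in> set [(1, 1), (1, -1), (-1, 1), (-1, -1)]"
        | "(x, y) \<in> set [(3, 1), (3, -1), (-3, 1), (-3, -1), (1, 3), (1, -3), (-1, 3), (-1, -3)]"
        by auto
      then show ?thesis
      proof cases
        case 1
        then have "forces merged 5 S" using forces_2 valid unfolding S list_all_iff by fast
        then show ?thesis using forces_merges[of merged] merged by blast
      next
        case 2
        then have "forces (\<lambda>S. norm2 S < 10) 2 S" using forces_10 valid unfolding S list_all_iff by fast
        moreover have "x * x + y * y = 10" using 2 by auto
        ultimately show ?thesis using forces_merges[of "\<lambda>S. norm2 S < 10"] IH by simp
      qed
    qed
  qed
qed

section \<open>A single covering curve\<close>

text \<open>A Baire category argument: each requirement contains a dense open set of sequences.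
  \<open>Q\<close> lengthens a fixed prefix, stored as its length and a sequence, so as to secure
  one more requirement.\<close>

lemma dense_open_sequence:
  fixes R :: "'i::countable \<Rightarrow> (nat \<Rightarrow> 'a) \<Rightarrow> bool"
  assumes dense: "\<And>i m t. \<exists>m' t'. (\<forall>k<m. t' k = t k) \<and> (\<forall>t''. (\<forall>k<m'. t'' k = t' k) \<longrightarrow> R i t'')"
  shows "\<exists>t. \<forall>i. R i t"
proof -
  define Q where "Q n x y \<longleftrightarrow> fst x < fst y \<and> (\<forall>k<fst x. snd y k = snd x k) \<and>
      (\<forall>t''. (\<forall>k<fst y. t'' k = snd y k) \<longrightarrow> R (from_nat n) t'')"
    for n and x y :: "nat \<times> (nat \<Rightarrow> 'a)"
  have "\<exists>f. \<forall>n. True \<and> Q n (f n) (f (Suc n))"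
  proof (rule dependent_nat_choice)
    fix x :: "nat \<times> (nat \<Rightarrow> 'a)" and n
    obtain m' t' where "\<forall>k<fst x. t' k = snd x k" "\<And>t''. \<forall>k<m'. t'' k = t' k \<Longrightarrow> R (from_nat n) t''"
      using dense[of "fst x" "snd x" "from_nat n"] by blast
    then have "Q n x (max m' (Suc (fst x)), t')" unfolding Q_def by auto
    then show "\<exists>y. True \<and> Q n x y" by blast
  qed simp
  then obtain f where f: "\<And>n. Q n (f n) (f (Suc n))" by blast
  have less: "fst (f n) < fst (f (Suc n))" for n using f[of n] unfolding Q_def by blast
  have le: "fst (f n) \<le> fst (f m)" if "n \<le> m" for n m
    using lift_Suc_mono_le[of "\<lambda>n. fst (f n)", OF _ that] less less_imp_le by blast
  have n_le: "n \<le> fst (f n)" for n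
    by (induction n) (use less in \<open>auto intro: Suc_leI le_less_trans\<close>)
  have agree: "snd (f m) k = snd (f n) k" if "n \<le> m" "k < fst (f n)" for n m k
    using that(1)
  proof (induction m rule: dec_induct)
    case (step m)
    then have "k < fst (f m)" using le[of n m] that(2) by simp
    then show ?case using f[of m] step.IH unfolding Q_def by simp
  qed simp
  define t where "t k = snd (f (Suc k)) k" for k
  have t: "t k = snd (f n) k" if "k < fst (f n)" for n k
  proof (cases "n \<le> Suc k")
    case True
    then show ?thesis unfolding t_def using agree[OF True that] by simp
  next
    case False
    have "k < fst (f (Suc k))" using n_le[of "Suc k"] by simp
    then show ?thesis unfolding t_def using agree[of "Suc k" n k] False by simp
  qed
  have "R i t" for i
  proof -
    have "\<forall>t''. (\<forall>k<fst (f (Suc (to_nat i))). t'' k = snd (f (Suc (to_nat i))) k) \<longrightarrow> R i t''"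
      using f[of "to_nat i"] unfolding Q_def by simp
    then show ?thesis using t by blast
  qed
  then show ?thesis by blast
qed

lemma ancestor_cong: "(\<And>k. k < n \<Longrightarrow> t k = t' k) \<Longrightarrow> ancestor n s t e = ancestor n s t' e"
proof (induction n arbitrary: s t t' e)
  case (Suc n)
  have "t 0 = t' 0" by (simp add: Suc.prems)
  then show ?case
    using Suc.IH[of "\<lambda>k. t (Suc k)" "\<lambda>k. t' (Suc k)"] Suc.prems by simp
qed simp

text \<open>Changing the translation by 1 switches between keeping and rotating the unit
  vector.\<close>

lemma parent_vert:
  assumes "s \<in> {1, -1}" "e \<in> edges"
  shows "\<exists>t. vert (parent s t e) = v"
  using assms(2)
proof (cases rule: edges_cases)
  case (E x y a b)
  define r where "r = (x + s * y) div 2 + (y - s * x) div 2"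
  have t: "even ((x + s * y) div 2 + t + (y - s * x) div 2) \<longleftrightarrow> even (r + t)" for t
    by (rule arg_cong[where f = even]) (simp add: r_def)
  have "vert (parent s r e) \<longleftrightarrow> a = 0" "vert (parent s (r + 1) e) \<longleftrightarrow> s * b = 0"
    unfolding E(1) parent.simps Let_def t by simp_all
  moreover have "a = 0 \<longleftrightarrow> s * b \<noteq> 0" using assms(1) E(3) by auto
  ultimately show ?thesis by metis
qed

text \<open>The requirements are countable, and each can be secured after any prefix by finitely
  many further translations: merging by \<open>merges_all\<close>, recurrence by
  \<open>parent_vert\<close>.\<close>

lemma merging_translations:
  assumes s: "signs s" and e0: "e0 \<in> edges"
  shows "\<exists>t. (\<forall>e\<in>edges. \<exists>n. ancestor n s t e = ancestor n s t e0) \<and>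
             (\<forall>m v. \<exists>k\<ge>m. vert (ancestor k s t e0) = v)"
proof -
  define R where "R i t = (case i of
      Inl e \<Rightarrow> e \<in> edges \<longrightarrow> (\<exists>n. ancestor n s t e = ancestor n s t e0)
    | Inr (m, v) \<Rightarrow> \<exists>k\<ge>m. vert (ancestor k s t e0) = v)"
    for i :: "edge + nat \<times> bool" and t
  have "\<exists>t. \<forall>i. R i t"
  proof (rule dense_open_sequence)
    fix i m t
    show "\<exists>m' t'. (\<forall>k<m. t' k = t k) \<and> (\<forall>t''. (\<forall>k<m'. t'' k = t' k) \<longrightarrow> R i t'')"
    proof (cases i)
      case (Inl e)
      show ?thesis
      proof (cases "e \<in> edges")
        case True
        let ?s = "\<lambda>k. s (m + k)"
        \<comment> \<open>Merging the ancestors of level \<open>m\<close>, under the signs from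
          there on, leaves the given prefix untouched.\<close>
        obtain n t1 where n: "ancestor n ?s t1 (ancestor m s t e) = ancestor n ?s t1 (ancestor m s t e0)"
          using merges_all[unfolded merges_def, rule_format, OF signs_shift[OF s]
              ancestor_edges[OF s True] ancestor_edges[OF s e0] refl] by blast
        define t' where "t' k = (if k < m then t k else t1 (k - m))" for k
        have eq: "ancestor (m + n) s t'' f = ancestor n ?s t1 (ancestor m s t f)"
          if "\<forall>k<m + n. t'' k = t' k" for t'' f
        proof -
          have "ancestor m s t'' f = ancestor m s t f"
            by (rule ancestor_cong) (use that in \<open>simp add: t'_def\<close>)
          moreover have "ancestor n ?s (\<lambda>k. t'' (m + k)) g = ancestor n ?s t1 g" for g
            by (rule ancestor_cong) (use that in \<open>simp add: t'_def\<close>)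
          ultimately show ?thesis by (simp add: ancestor_add)
        qed
        have "R i t''" if t'': "\<forall>k<m + n. t'' k = t' k" for t''
        proof -
          have "ancestor (m + n) s t'' e = ancestor (m + n) s t'' e0"
            unfolding eq[OF t''] by (rule n)
          then show ?thesis unfolding R_def Inl by auto
        qed
        then show ?thesis by (intro exI[of _ "m + n"] exI[of _ t']) (simp add: t'_def)
      next
        case False
        then show ?thesis unfolding R_def Inl by auto
      qed
    next
      case (Inr mv)
      obtain m0 v where mv: "mv = (m0, v)" by (cases mv)
      define M where "M = max m m0"
      have sM: "s M \<in> {1, -1}" using s by (simp add: signs_def)
      obtain t1 where t1: "vert (parent (s M) t1 (ancestor M s t e0)) = v"
        using parent_vert[OF sM ancestor_edges[OF s e0]] by blast
      have "R i t''" if t'': "\<forall>k<Suc M. t'' k = (t(M := t1)) k" for t''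
      proof -
        have "ancestor M s t'' e0 = ancestor M s t e0" by (rule ancestor_cong) (use t'' in simp)
        moreover have "t'' M = t1" using t'' by simp
        ultimately have "vert (ancestor (Suc M) s t'' e0) = v"
          using t1 ancestor_add[of M 1 s t'' e0] by simp
        moreover have "m0 \<le> Suc M" by (simp add: M_def)
        ultimately show ?thesis unfolding R_def Inr mv by auto
      qed
      moreover have "\<forall>k<m. (t(M := t1)) k = t k" by (simp add: M_def)
      ultimately show ?thesis by blast
    qed
  qed
  then obtain t where t: "\<And>i. R i t" by blast
  have "\<exists>n. ancestor n s t e = ancestor n s t e0" if "e \<in> edges" for e
    using t[of "Inl e"] that by (simp add: R_def)
  moreover have "\<exists>k\<ge>m. vert (ancestor k s t e0) = v" for m v
    using t[of "Inr (m, v)"] by (simp add: R_def)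
  ultimately show ?thesis by blast
qed

theorem theorem3p7:
  fixes S :: "int \<Rightarrow> int"
  assumes "complete_folding_sequence S"
  shows "\<exists>D. complete_folding_curve D \<and>
             locally_isomorphic (associated_sequence D) S \<and>
             covers_plane D"
proof -
  obtain s where s: "signs s" and S: "folding_type s S"
    using complete_folding_sequence_type(1)[OF assms] by blast
  have e0: "((0, 0), (1, 0)) \<in> edges" by (simp add: edges_iff)
  obtain t where t: "\<And>e. e \<in> edges \<Longrightarrow> \<exists>n. ancestor n s t e = ancestor n s t ((0, 0), (1, 0))"
    "\<And>m v. \<exists>k\<ge>m. vert (ancestor k s t ((0, 0), (1, 0))) = v"
    using merging_translations[OF s e0] by blast
  obtain D where D: "complete_curve D" "folding_type s (associated_sequence D)" "covers_plane D"
    using curve_of_ancestors[OF s e0 t] by blast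
  have "associated_sequence D k \<in> {1, -1}" for k by (simp add: associated_sequence_def)
  then have "subwords (associated_sequence D) = subwords S"
    using folding_type_subwords[OF s D(2) S] folding_type_subwords[OF s S D(2)]
      complete_folding_sequence_type(2)[OF assms] by blast
  \<comment> \<open>Being a complete folding sequence depends on the subwords only, so it passes
    from \<open>S\<close> to the curve.\<close>
  then have "locally_isomorphic (associated_sequence D) S" "complete_folding_curve D"
    using D(1) assms by (simp_all add: locally_isomorphic_def complete_folding_curve_def complete_folding_sequence_def)
  then show ?thesis using D(3) by blast
qed

end
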